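(* Let $k,r$ be positive integers and $x\in(0,1)$. Then $$\begin{aligned}\mathrm{Li}_{k,\{1\}_{r-1}}(x)=&\sum_{j=1}^{k-1}\frac{\log^{k-1-j}(x)}{(k-1-j)!}\Bigl\{\zeta(r+1,\{1\}_{j-1})-\sum_{i=0}^{r-1}\frac{(-1)^i}{i!}\log^i(1-x)\,\mathrm{Li}_{r+1-i,\{1\}_{j-1}}(1-x)\Bigr\}\\&+(-1)^r\frac{\log^{k-1}(x)\log^r(1-x)}{(k-1)!\,r!}.\end{aligned}$$
   Context: $\mathrm{Li}_{k_1,\ldots,k_r}(x)=\sum_{n_1>\cdots>n_r\ge1}x^{n_1}/(n_1^{k_1}\cdots n_r^{k_r})$; $\zeta(k_1,\ldots,k_r)=\sum_{n_1>\cdots>n_r\ge1}\prod n_j^{-k_j}$ for $k_1\ge2$; $\{1\}_d$ is $1$ repeated $d$ times (empty for $d=0$). *)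

theory Defs
  imports "HOL-Analysis.Analysis"
begin

text \<open>A tuple \<open>n\<^sub>1 > \<dots> > n\<^sub>r \<ge> 1\<close> is the list \<open>[n\<^sub>1, \<dots>, n\<^sub>r]\<close>; list positions count from 0.\<close>

definition decreasing_tuples :: "nat \<Rightarrow> nat list set" where
  "decreasing_tuples r =
     {ns. length ns = r \<and> sorted_wrt (>) ns \<and> (\<forall>n\<in>set ns. n \<ge> 1)}"

text \<open>Both definitions below are meant for a nonempty index list. The unordered sum
  \<^const>\<open>infsum\<close> is 0 for a family that is not summable; for \<open>0 \<le> x < 1\<close>, and for
  \<open>k\<^sub>1 \<ge> 2\<close> with positive entries in the case of zeta, all terms are nonnegative and the
  family is summable, so the order of summation is irrelevant.\<close>

definition multi_polylog :: "nat list \<Rightarrow> real \<Rightarrow> real" where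
  "multi_polylog ks x =
     (\<Sum>\<^sub>\<infinity>ns\<in>decreasing_tuples (length ks).
        x ^ hd ns / (\<Prod>j<length ks. real (ns ! j) ^ (ks ! j)))"

definition multi_zeta :: "nat list \<Rightarrow> real" where
  "multi_zeta ks =
     (\<Sum>\<^sub>\<infinity>ns\<in>decreasing_tuples (length ks).
        \<Prod>j<length ks. 1 / real (ns ! j) ^ (ks ! j))"

end

theory Submission
  imports Defs
begin

text \<open>
  Both sides are determined by an ordinary differential equation in \<open>x\<close> and by their limit at
  \<open>0\<close>. Write \<open>B\<^sub>0 = (- ln (1 - x))\<^sup>r / r!\<close>, and \<open>B\<^sub>j\<close> for the brace with index \<open>j \<ge> 1\<close>, so that
  the right-hand side is \<open>R\<^sub>k = \<Sum>\<^sub>j (ln x)\<^bsup>k-1-j\<^esup> / (k-1-j)! B\<^sub>j\<close> with \<open>j = 0, \<dots>, k-1\<close>. The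
  derivative of the inner sum over \<open>i\<close> telescopes, which leaves
  \<open>B\<^sub>j' = B\<^sub>0' (- ln x)\<^sup>j / j!\<close> for all \<open>j \<ge> 0\<close>. Hence the terms of \<open>R\<^sub>k'\<close> that contain some \<open>B\<^sub>j'\<close>
  add up to \<open>B\<^sub>0' (ln x - ln x)\<^bsup>k-1\<^esup> / (k-1)! = 0\<close> for \<open>k \<ge> 2\<close>, and \<open>R\<^sub>k' = R\<^sub>k\<^sub>-\<^sub>1 / x\<close>, the equation
  satisfied by the polylogarithm. The zeta values are precisely what makes every \<open>B\<^sub>j\<close> vanish at
  \<open>0\<close>, fast enough to beat all powers of \<open>ln x\<close>. The case \<open>k = 1\<close> is the classical
  formula for the polylogarithm with all indices \<open>1\<close>.
\<close>

section \<open>Decreasing tuples, split into leading entry and tail\<close>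

text \<open>These are the possible tails under a leading entry \<open>n\<close>. For fixed
  \<open>n\<close> there are finitely many, so only the sum over the leading entry is
  infinite.\<close>

definition tuples_below :: "nat \<Rightarrow> nat \<Rightarrow> nat list set" where
  "tuples_below d n = {ns \<in> decreasing_tuples d. \<forall>m\<in>set ns. m < n}"

lemma decreasing_tuples_Suc:
  "decreasing_tuples (Suc d) = (\<lambda>(n, ns). n # ns) ` (SIGMA n:{1..}. tuples_below d n)"
proof -
  have "ns \<in> (\<lambda>(n, ns). n # ns) ` (SIGMA n:{1..}. tuples_below d n)"
    if "ns \<in> decreasing_tuples (Suc d)" for ns
    using that by (cases ns) (auto simp: decreasing_tuples_def tuples_below_def image_iff)
  moreover have "ns \<in> decreasing_tuples (Suc d)"
    if "ns \<in> (\<lambda>(n, ns). n # ns) ` (SIGMA n:{1..}. tuples_below d n)" for ns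
    using that by (auto simp: decreasing_tuples_def tuples_below_def)
  ultimately show ?thesis by blast
qed

lemma tuples_below_0: "tuples_below 0 n = {[]}"
  by (auto simp: tuples_below_def decreasing_tuples_def)

lemma tuples_below_Suc:
  "tuples_below (Suc d) n = (\<lambda>(m, ns). m # ns) ` (SIGMA m:{1..<n}. tuples_below d m)"
proof -
  have "ns \<in> (\<lambda>(n, ns). n # ns) ` (SIGMA m:{1..<n}. tuples_below d m)"
    if "ns \<in> tuples_below (Suc d) n" for ns
    using that by (cases ns) (auto simp: decreasing_tuples_def tuples_below_def image_iff)
  moreover have "ns \<in> tuples_below (Suc d) n"
    if "ns \<in> (\<lambda>(n, ns). n # ns) ` (SIGMA m:{1..<n}. tuples_below d m)" for ns
    using that by (force simp: decreasing_tuples_def tuples_below_def)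
  ultimately show ?thesis by blast
qed

lemma finite_tuples_below: "finite (tuples_below d n)"
  by (induction d arbitrary: n) (simp_all add: tuples_below_0 tuples_below_Suc)

text \<open>The multiple harmonic sum of depth \<open>d\<close> with all exponents 1, truncated
  strictly below \<open>n\<close> so that \<open>n\<close> can serve as the next larger
  index.\<close>

primrec hsum :: "nat \<Rightarrow> nat \<Rightarrow> real" where
  "hsum 0 n = 1"
| "hsum (Suc d) n = (\<Sum>m = 1..<n. hsum d m / real m)"

lemma inj_on_Cons_pair: "inj_on (\<lambda>(n, ns). n # ns) A"
  by (auto simp: inj_on_def)

lemma hsum_altdef: "hsum d n = (\<Sum>ns\<in>tuples_below d n. \<Prod>j<d. 1 / real (ns ! j))"
proof (induction d arbitrary: n)
  case 0
  show ?case by (simp add: tuples_below_0)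
next
  case (Suc d)
  have "(\<Sum>ns\<in>tuples_below (Suc d) n. \<Prod>j<Suc d. 1 / real (ns ! j))
      = (\<Sum>(m, ns)\<in>(SIGMA m:{1..<n}. tuples_below d m). \<Prod>j<Suc d. 1 / real ((m # ns) ! j))"
    unfolding tuples_below_Suc
    by (subst sum.reindex[OF inj_on_Cons_pair]) (simp add: case_prod_unfold)
  also have "\<dots> = (\<Sum>m = 1..<n. \<Sum>ns\<in>tuples_below d m. (\<Prod>j<d. 1 / real (ns ! j)) / real m)"
    by (subst sum.Sigma) (auto simp: finite_tuples_below prod.lessThan_Suc_shift
        simp del: prod.lessThan_Suc)
  also have "\<dots> = hsum (Suc d) n"
    by (simp add: Suc.IH sum_divide_distrib)
  finally show ?case ..
qed

lemma hsum_nonneg: "hsum d n \<ge> 0"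
  by (induction d arbitrary: n) (auto intro!: sum_nonneg divide_nonneg_nonneg)

text \<open>Fubini over leading entry and tail: the inner sums are finite, and nonnegativity carries
  summability from the outer series to the whole family. The factor \<open>c\<close> is kept general
  so that polylogarithm and zeta value are both covered; \<open>c 0 = 0\<close> bridges series over
  all naturals and leading entries that start at 1.\<close>

lemma infsum_decreasing_tuples:
  fixes c :: "nat \<Rightarrow> real"
  assumes "c 0 = 0" "\<And>n. c n \<ge> 0" "summable (\<lambda>n. c n * hsum d n)"
  shows "(\<Sum>\<^sub>\<infinity>ns\<in>decreasing_tuples (Suc d). c (hd ns) * (\<Prod>j<d. 1 / real (ns ! Suc j)))
           = (\<Sum>n. c n * hsum d n)"
proof -
  have "((\<lambda>n. c n * hsum d n) has_sum (\<Sum>n. c n * hsum d n)) UNIV"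
    using assms by (intro norm_summable_imp_has_sum) (auto simp: hsum_nonneg summable_sums)
  also have "?this \<longleftrightarrow> ((\<lambda>n. c n * hsum d n) has_sum (\<Sum>n. c n * hsum d n)) {1..}"
    using assms(1) by (intro has_sum_cong_neutral) (auto simp: not_le)
  finally have outer: "((\<lambda>n. c n * hsum d n) has_sum (\<Sum>n. c n * hsum d n)) {1..}" .
  have inner: "((\<lambda>ns. c n * (\<Prod>j<d. 1 / real (ns ! j))) has_sum (c n * hsum d n)) (tuples_below d n)" for n
    using has_sum_finite[OF finite_tuples_below, of "\<lambda>ns. c n * (\<Prod>j<d. 1 / real (ns ! j))" d n]
    by (simp add: hsum_altdef sum_distrib_left)
  have "((\<lambda>(n, ns). c n * (\<Prod>j<d. 1 / real (ns ! j))) has_sum (\<Sum>n. c n * hsum d n))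
          (SIGMA n:{1..}. tuples_below d n)"
  proof (rule has_sum_SigmaI[where g = "\<lambda>n. c n * hsum d n"])
    show "(\<lambda>(n, ns). c n * (\<Prod>j<d. 1 / real (ns ! j))) summable_on (SIGMA n:{1..}. tuples_below d n)"
      using inner outer assms(2)
      by (intro summable_on_SigmaI[where g = "\<lambda>n. c n * hsum d n"])
         (auto intro!: mult_nonneg_nonneg prod_nonneg simp: summable_on_def)
  qed (use inner outer in auto)
  then have "((\<lambda>ns. c (hd ns) * (\<Prod>j<d. 1 / real (ns ! Suc j))) has_sum (\<Sum>n. c n * hsum d n))
          (decreasing_tuples (Suc d))"
    unfolding decreasing_tuples_Suc
    by (subst has_sum_reindex[OF inj_on_Cons_pair]) (simp add: o_def case_prod_unfold)
  then show ?thesis by (rule infsumI)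
qed

section \<open>Logarithmic growth and summability\<close>

text \<open>The difference \<open>harm n - ln n\<close> decreases from its value 1 at
  \<open>n = 1\<close>.\<close>

lemma harm_le_one_plus_ln: "n \<ge> 1 \<Longrightarrow> harm n \<le> 1 + ln (real n)"
  using decseqD[OF decseq_harm_diff_ln, of 0 "n - 1"] by (simp add: harm_expand)

text \<open>Each nested summation costs at most one harmonic number, that is, one factor
  \<open>1 + ln n\<close>. Growth this slow allows comparison with \<open>n powr (-3/2)\<close> in
  both summability proofs below.\<close>

lemma hsum_le: "n \<ge> 1 \<Longrightarrow> hsum d n \<le> (1 + ln (real n)) ^ d"
proof (induction d arbitrary: n)
  case (Suc d)
  have "hsum (Suc d) n \<le> (\<Sum>m = 1..<n. (1 + ln (real n)) ^ d / real m)"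
    unfolding hsum.simps
  proof (intro sum_mono divide_right_mono)
    fix m assume m: "m \<in> {1..<n}"
    then have "hsum d m \<le> (1 + ln (real m)) ^ d" using Suc.IH by simp
    also have "\<dots> \<le> (1 + ln (real n)) ^ d" using m by (intro power_mono) auto
    finally show "hsum d m \<le> (1 + ln (real n)) ^ d" .
  qed auto
  also have "\<dots> = (1 + ln (real n)) ^ d * (\<Sum>m = 1..<n. inverse (real m))"
    by (simp add: sum_distrib_left field_simps)
  also have "\<dots> \<le> (1 + ln (real n)) ^ d * (\<Sum>m = 1..n. inverse (real m))"
    using Suc.prems by (intro mult_left_mono sum_mono2) auto
  also have "\<dots> \<le> (1 + ln (real n)) ^ d * (1 + ln (real n))"
    using Suc.prems harm_le_one_plus_ln[of n] by (intro mult_left_mono) (auto simp: harm_def)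
  finally show ?case by (simp add: mult.commute)
qed auto

lemma hsum_bigo: "hsum d \<in> O(\<lambda>n. (1 + ln (real n)) ^ d)"
  by (rule bigoI[where c = 1])
     (use hsum_le hsum_nonneg in \<open>auto intro!: eventually_at_top_linorderI[of 1]\<close>)

lemma summable_hsum_zeta:
  assumes "k \<ge> 2"
  shows "summable (\<lambda>n. hsum d n / real n ^ k)"
proof (rule summable_comparison_test_bigo)
  show "summable (\<lambda>n. norm (real n powr (-3/2)))"
    by (simp add: summable_real_powr_iff)
  have "hsum d n / real n ^ k \<le> (1 + ln (real n)) ^ d / real n ^ 2" if "n \<ge> 1" for n
    using that assms by (intro frac_le hsum_le power_increasing) (auto simp: hsum_nonneg)
  then have "(\<lambda>n. hsum d n / real n ^ k) \<in> O(\<lambda>n. (1 + ln (real n)) ^ d / real n ^ 2)"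
    by (intro bigoI[where c = 1] eventually_at_top_linorderI[of 1]) (auto simp: hsum_nonneg)
  also have "(\<lambda>n. (1 + ln (real n)) ^ d / real n ^ 2) \<in> O(\<lambda>n. real n powr (-3/2))"
    by real_asymp
  finally show "(\<lambda>n. hsum d n / real n ^ k) \<in> O(\<lambda>n. real n powr (-3/2))" .
qed

lemma summable_hsum_power:
  fixes x :: real
  assumes "norm x < 1"
  shows "summable (\<lambda>n. hsum d n / real n ^ k * x ^ n)"
proof (cases "x = 0")
  case False
  \<comment> \<open>The asymptotic comparison is made for a positive base, hence the separate case
    \<open>x = 0\<close>.\<close>
  define y where "y = norm x"
  have y: "0 < y" "y < 1" using False assms by (auto simp: y_def)
  show ?thesis
  proof (rule summable_comparison_test_bigo)
    show "summable (\<lambda>n. norm (real n powr (-3/2)))"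
      by (simp add: summable_real_powr_iff)
    have "hsum d n / real n ^ k * y ^ n \<le> (1 + ln (real n)) ^ d * y ^ n" if "n \<ge> 1" for n
    proof -
      have "hsum d n / real n ^ k \<le> (1 + ln (real n)) ^ d / 1"
        using that by (intro frac_le hsum_le) (auto simp: hsum_nonneg)
      then show ?thesis using y by (intro mult_right_mono) auto
    qed
    then have "(\<lambda>n. hsum d n / real n ^ k * x ^ n) \<in> O(\<lambda>n. (1 + ln (real n)) ^ d * y ^ n)"
      by (intro bigoI[where c = 1] eventually_at_top_linorderI[of 1])
         (auto simp: hsum_nonneg abs_mult power_abs y_def)
    also have "(\<lambda>n. (1 + ln (real n)) ^ d * y ^ n) \<in> O(\<lambda>n. real n powr (-3/2))"
      using y by real_asymp
    finally show "(\<lambda>n. hsum d n / real n ^ k * x ^ n) \<in> O(\<lambda>n. real n powr (-3/2))" .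
  qed
qed (simp only: summable_0_powser)

section \<open>Reduction of the multiple series to single series\<close>

text \<open>The term \<open>n = 0\<close> vanishes for \<open>k \<ge> 1\<close> because \<open>1 / 0 = 0\<close>.\<close>

definition polylog_ones :: "nat \<Rightarrow> nat \<Rightarrow> real \<Rightarrow> real" where
  "polylog_ones k d x = (\<Sum>n. hsum d n / real n ^ k * x ^ n)"

definition zeta_ones :: "nat \<Rightarrow> nat \<Rightarrow> real" where
  "zeta_ones k d = (\<Sum>n. hsum d n / real n ^ k)"

lemma prod_index_ones:
  assumes "ns \<in> decreasing_tuples (Suc d)"
  shows "(\<Prod>j<Suc d. real (ns ! j) ^ ((k # replicate d 1) ! j))
       = real (hd ns) ^ k * (\<Prod>j<d. real (ns ! Suc j))"
proof -
  have "ns \<noteq> []" using assms by (auto simp: decreasing_tuples_def)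
  then show ?thesis
    by (simp add: prod.lessThan_Suc_shift hd_conv_nth del: prod.lessThan_Suc)
qed

lemma multi_polylog_ones:
  assumes "k \<ge> 1" "0 \<le> x" "x < 1"
  shows "multi_polylog (k # replicate d 1) x = polylog_ones k d x"
proof -
  have "multi_polylog (k # replicate d 1) x =
    (\<Sum>\<^sub>\<infinity>ns\<in>decreasing_tuples (Suc d).
       x ^ hd ns / real (hd ns) ^ k * (\<Prod>j<d. 1 / real (ns ! Suc j)))"
    unfolding multi_polylog_def length_Cons length_replicate
    by (intro infsum_cong) (simp only: prod_index_ones, simp add: prod_dividef)
  also have "\<dots> = (\<Sum>n. x ^ n / real n ^ k * hsum d n)"
    using assms summable_hsum_power[of x d k]
    by (intro infsum_decreasing_tuples) (auto simp: zero_power mult_ac)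
  finally show ?thesis by (simp add: polylog_ones_def mult_ac)
qed

lemma multi_zeta_ones:
  assumes "k \<ge> 2"
  shows "multi_zeta (k # replicate d 1) = zeta_ones k d"
proof -
  have "multi_zeta (k # replicate d 1) =
    (\<Sum>\<^sub>\<infinity>ns\<in>decreasing_tuples (Suc d).
       1 / real (hd ns) ^ k * (\<Prod>j<d. 1 / real (ns ! Suc j)))"
    unfolding multi_zeta_def length_Cons length_replicate prod_dividef
    by (intro infsum_cong) (simp only: prod_index_ones, simp)
  also have "\<dots> = (\<Sum>n. 1 / real n ^ k * hsum d n)"
    using assms summable_hsum_zeta[of k d]
    by (intro infsum_decreasing_tuples) (auto simp: zero_power)
  finally show ?thesis by (simp add: zeta_ones_def)
qed

section \<open>Derivatives and boundary values of the polylogarithms\<close>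

lemma polylog_ones_0 [simp]: "k \<ge> 1 \<Longrightarrow> polylog_ones k d 0 = 0"
  unfolding polylog_ones_def powser_zero by (simp add: zero_power)

lemma
  fixes x :: real and k d :: nat
  assumes "norm x < 1"
  defines "c \<equiv> \<lambda>n. hsum d n / real n ^ k"
  shows polylog_ones_has_derivative_powser:
      "(polylog_ones k d has_real_derivative (\<Sum>n. diffs c n * x ^ n)) (at x)"
    and polylog_ones_summable_diffs: "summable (\<lambda>n. diffs c n * x ^ n)"
proof -
  show "(polylog_ones k d has_real_derivative (\<Sum>n. diffs c n * x ^ n)) (at x)"
    unfolding c_def polylog_ones_def[abs_def]
    by (rule termdiffs_strong'[OF summable_hsum_power assms(1)])
  show "summable (\<lambda>n. diffs c n * x ^ n)"
    unfolding c_def by (rule termdiff_converges[OF assms(1) summable_hsum_power])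
qed

lemma polylog_ones_tendsto_0:
  assumes "k \<ge> 1"
  shows "(polylog_ones k d \<longlongrightarrow> 0) (at_right 0)"
proof -
  have "isCont (polylog_ones k d) 0"
    using DERIV_isCont[OF polylog_ones_has_derivative_powser[of 0 k d]] by simp
  then show ?thesis
    using assms by (simp add: isCont_def filterlim_at_split)
qed

text \<open>Termwise, the operator \<open>x d/dx\<close> multiplies the coefficient of
  \<open>x ^ n\<close> by \<open>n\<close> and so cancels one factor of the denominator.\<close>

lemma polylog_ones_has_derivative:
  assumes "k \<ge> 1" "x \<noteq> 0" "norm x < 1"
  shows "(polylog_ones (Suc k) d has_real_derivative polylog_ones k d x / x) (at x)"
proof -
  define c where "c = (\<lambda>n. hsum d n / real n ^ Suc k)"
  have "(\<lambda>n. real n * c n * x ^ (n - Suc 0)) sums (\<Sum>n. diffs c n * x ^ n)"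
    using diffs_equiv[OF polylog_ones_summable_diffs[of x d "Suc k"]] assms by (simp add: c_def)
  then have "(\<lambda>n. x * (real n * c n * x ^ (n - Suc 0))) sums (x * (\<Sum>n. diffs c n * x ^ n))"
    by (rule sums_mult)
  \<comment> \<open>At \<open>n = 0\<close> the left side is 0 by its factor \<open>n\<close>, the
    right side by division by zero, as \<open>k \<ge> 1\<close>.\<close>
  moreover have "x * (real n * c n * x ^ (n - Suc 0)) = hsum d n / real n ^ k * x ^ n" for n
    using assms by (cases n) (auto simp: c_def zero_power)
  ultimately have "polylog_ones k d x = x * (\<Sum>n. diffs c n * x ^ n)"
    by (simp add: sums_iff polylog_ones_def)
  then show ?thesis
    using polylog_ones_has_derivative_powser[of x "Suc k" d] assms by (simp add: c_def)
qed

text \<open>The derivative has the coefficients \<open>hsum d (Suc n)\<close>. Multiplying it by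
  \<open>1 - x\<close> takes their differences, and these undo the outermost summation in
  \<open>hsum\<close>.\<close>

lemma polylog_ones_1_has_derivative:
  assumes "norm x < 1"
  shows "(polylog_ones 1 d has_real_derivative
           (if d = 0 then 1 else polylog_ones 1 (d - 1) x) / (1 - x)) (at x)"
proof -
  define S where "S = (\<Sum>n. diffs (\<lambda>n. hsum d n / real n ^ 1) n * x ^ n)"
  have "diffs (\<lambda>n. hsum d n / real n ^ 1) = (\<lambda>n. hsum d (Suc n))"
    by (simp add: diffs_def fun_eq_iff del: hsum.simps of_nat_Suc)
  then have S: "(\<lambda>n. hsum d (Suc n) * x ^ n) sums S"
    using summable_sums[OF polylog_ones_summable_diffs[OF assms, of d 1]] by (simp add: S_def)
  then have "(\<lambda>n. hsum d (Suc n) * x ^ Suc n) sums (x * S)"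
    using sums_mult[OF S, of x] by (simp add: mult_ac)
  then have "(\<lambda>n. hsum d n * x ^ n) sums (x * S + hsum d 0 * x ^ 0)"
    by (subst (asm) sums_Suc_iff) simp
  then have *: "(\<lambda>n. (hsum d (Suc n) - hsum d n) * x ^ n) sums (S - (x * S + hsum d 0))"
    using sums_diff[OF S] by (simp add: left_diff_distrib del: hsum.simps)
  have "S * (1 - x) = (if d = 0 then 1 else polylog_ones 1 (d - 1) x)"
  proof (cases d)
    case 0
    with * show ?thesis by (simp add: sums_iff algebra_simps)
  next
    case (Suc e)
    \<comment> \<open>For \<open>n = 0\<close> both sides vanish: the sums on the left are empty,
      and the right side divides by zero.\<close>
    have "hsum d (Suc n) - hsum d n = hsum e n / real n ^ 1" for n
      using Suc by (cases n) auto
    with * Suc show ?thesis by (simp add: sums_iff algebra_simps polylog_ones_def)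
  qed
  with assms have "S = (if d = 0 then 1 else polylog_ones 1 (d - 1) x) / (1 - x)"
    by (auto simp: field_simps)
  then show ?thesis
    using polylog_ones_has_derivative_powser[OF assms, of 1 d] unfolding S_def by simp
qed

lemma has_derivative_divided_power:
  fixes f :: "real \<Rightarrow> real"
  assumes "(f has_real_derivative f') (at x)"
  shows "((\<lambda>x. f x ^ Suc n / fact (Suc n)) has_real_derivative f x ^ n / fact n * f') (at x)"
  by (rule DERIV_cong[OF DERIV_cdivide[OF DERIV_power[OF assms]]]) (simp add: divide_simps)

lemma has_derivative_minus_ln_1_minus:
  "x < 1 \<Longrightarrow> ((\<lambda>x. - ln (1 - x)) has_real_derivative 1 / (1 - x)) (at x)" for x :: real
  by (auto intro!: derivative_eq_intros simp: field_simps)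

text \<open>By induction on the depth, both sides have the same derivative on
  \<open>(-1, 1)\<close>, and both are 0 at 0.\<close>

lemma polylog_ones_1:
  assumes "norm x < 1"
  shows "polylog_ones 1 d x = (- ln (1 - x)) ^ Suc d / fact (Suc d)"
  using assms
proof (induction d arbitrary: x)
  case (0 x)
  define f where "f = (\<lambda>x. polylog_ones 1 0 x - (- ln (1 - x)))"
  have "(f has_real_derivative 0) (at y)" if "-1 < y" "y < 1" for y
    unfolding f_def using that
    by (auto intro!: derivative_eq_intros polylog_ones_1_has_derivative[of y 0, simplified]
         simp: field_simps)
  then have "f x = f 0"
    using "0.prems" by (intro DERIV_isconst3[of "-1" 1]) auto
  then show ?case by (simp add: f_def)
next
  case (Suc d x)
  define f where "f = (\<lambda>x. polylog_ones 1 (Suc d) x - (- ln (1 - x)) ^ (Suc (Suc d)) / fact (Suc (Suc d)))"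
  have "(f has_real_derivative 0) (at y)" if "-1 < y" "y < 1" for y
  proof -
    have "((\<lambda>x. (- ln (1 - x)) ^ Suc (Suc d) / fact (Suc (Suc d))) has_real_derivative
            (- ln (1 - y)) ^ Suc d / fact (Suc d) * (1 / (1 - y))) (at y)"
      using that by (intro has_derivative_divided_power has_derivative_minus_ln_1_minus) auto
    moreover have "(polylog_ones 1 (Suc d) has_real_derivative
            (- ln (1 - y)) ^ Suc d / fact (Suc d) * (1 / (1 - y))) (at y)"
      using polylog_ones_1_has_derivative[of y "Suc d"] Suc.IH[of y] that by simp
    ultimately show ?thesis
      unfolding f_def using DERIV_diff by fastforce
  qed
  then have "f x = f 0"
    using Suc.prems by (intro DERIV_isconst3[of "-1" 1]) auto
  then show ?case by (simp add: f_def)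
qed

text \<open>For \<open>k \<ge> 2\<close> the coefficients themselves form a convergent majorant on
  \<open>[0, 1]\<close>, so the polylogarithm is continuous up to the endpoint 1.\<close>

lemma polylog_ones_tendsto_zeta_ones:
  assumes "k \<ge> 2"
  shows "((\<lambda>x. polylog_ones k d (1 - x)) \<longlongrightarrow> zeta_ones k d) (at_right 0)"
proof -
  have "uniform_limit {0..1} (\<lambda>N x. \<Sum>n<N. hsum d n / real n ^ k * x ^ n)
          (polylog_ones k d) sequentially"
    unfolding polylog_ones_def
  proof (rule Weierstrass_m_test[OF _ summable_hsum_zeta[OF assms]])
    fix n and x :: real
    assume "x \<in> {0..1}"
    then have "hsum d n / real n ^ k * x ^ n \<ge> 0" "hsum d n / real n ^ k * x ^ n \<le> hsum d n / real n ^ k"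
      using mult_left_le[of "x ^ n" "hsum d n / real n ^ k"] by (auto simp: hsum_nonneg power_le_one)
    then show "norm (hsum d n / real n ^ k * x ^ n) \<le> hsum d n / real n ^ k"
      by simp
  qed
  then have "continuous_on {0..1} (polylog_ones k d)"
    by (rule uniform_limit_theorem[rotated]) (auto intro!: always_eventually continuous_on_sum continuous_on_mult_left continuous_intros
         simp del: times_divide_eq_left)
  then have "continuous_on {0..1} (\<lambda>x. polylog_ones k d (1 - x))"
    by (rule continuous_on_compose2) (auto intro!: continuous_intros)
  then have "((\<lambda>x. polylog_ones k d (1 - x)) \<longlongrightarrow> polylog_ones k d (1 - 0)) (at 0 within {0..1})"
    by (rule continuous_on[THEN iffD1, THEN bspec]) simp
  then show ?thesis by (simp add: at_within_Icc_at_right polylog_ones_def zeta_ones_def)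
qed

section \<open>Derivatives and boundary behaviour of the braces\<close>

text \<open>The functions \<open>B\<^sub>j\<close> of the introduction.\<close>

definition polylog_defect :: "nat \<Rightarrow> nat \<Rightarrow> real \<Rightarrow> real" where
  "polylog_defect r j x =
     (if j = 0 then (- ln (1 - x)) ^ r / fact r
      else zeta_ones (r + 1) (j - 1) -
        (\<Sum>i<r. (- ln (1 - x)) ^ i / fact i * polylog_ones (r + 1 - i) (j - 1) (1 - x)))"

lemma polylog_defect_has_derivative:
  assumes "r \<ge> 1" "0 < x" "x < 1"
  shows "(polylog_defect r j has_real_derivative
           (- ln (1 - x)) ^ (r - 1) / fact (r - 1) / (1 - x) * ((- ln x) ^ j / fact j)) (at x)"
proof (cases j)
  case 0
  obtain q where q: "r = Suc q" using assms(1) by (cases r) auto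
  show ?thesis
    using has_derivative_divided_power[OF has_derivative_minus_ln_1_minus[OF assms(3)], of q]
    by (simp add: polylog_defect_def[abs_def] 0 q)
next
  case (Suc p)
  define T where "T = (\<lambda>i x. (- ln (1 - x)) ^ i / fact i * polylog_ones (r + 1 - i) p (1 - x))"
  \<comment> \<open>\<open>V i\<close> arises from differentiating the log power in
    \<open>T i\<close>, and \<open>- V (Suc i)\<close> from lowering the leading index of its
    polylogarithm. \<open>V 0 = 0\<close> since the zeroth power is constant.\<close>
  define V where "V = (\<lambda>i. if i = 0 then 0 else
     (- ln (1 - x)) ^ (i - 1) / fact (i - 1) * polylog_ones (r + 1 - i) p (1 - x) / (1 - x))"
  have "(T i has_real_derivative V i - V (Suc i)) (at x)" if "i < r" for i
  proof -
    have "((\<lambda>x. 1 - x) has_real_derivative -1) (at x)"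
      by (auto intro!: derivative_eq_intros)
    moreover have "(polylog_ones (Suc (r - i)) p has_real_derivative
        polylog_ones (r - i) p (1 - x) / (1 - x)) (at (1 - x))"
      using that assms by (intro polylog_ones_has_derivative) auto
    ultimately have P: "((\<lambda>x. polylog_ones (r + 1 - i) p (1 - x)) has_real_derivative
        - polylog_ones (r - i) p (1 - x) / (1 - x)) (at x)"
      using DERIV_chain2[of "polylog_ones (Suc (r - i)) p" _ "\<lambda>x. 1 - x" x "-1"] that
      by (simp add: Suc_diff_le)
    show ?thesis
    proof (cases i)
      case 0
      with P show ?thesis by (simp add: T_def V_def)
    next
      case i: (Suc h)
      have "((\<lambda>x. (- ln (1 - x)) ^ i / fact i) has_real_derivative
              (- ln (1 - x)) ^ h / fact h * (1 / (1 - x))) (at x)"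
        unfolding i using assms(3)
        by (intro has_derivative_divided_power has_derivative_minus_ln_1_minus)
      from DERIV_mult[OF this P] show ?thesis
        unfolding T_def by (rule DERIV_cong) (simp add: V_def i mult_ac)
    qed
  qed
  then have "((\<lambda>x. \<Sum>i<r. T i x) has_real_derivative (\<Sum>i<r. V i - V (Suc i))) (at x)"
    by (intro DERIV_sum) auto
  moreover have "(\<Sum>i<r. V i - V (Suc i)) =
      - ((- ln (1 - x)) ^ (r - 1) / fact (r - 1) / (1 - x) * ((- ln x) ^ j / fact j))"
    \<comment> \<open>Only \<open>- V r\<close> survives. Its polylogarithm has leading index 1 and
      argument \<open>1 - x\<close>, hence is a divided power of \<open>- ln x\<close>.\<close>
    unfolding sum_lessThan_telescope' using assms polylog_ones_1[of "1 - x" p]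
    by (simp add: V_def Suc del: fact_Suc power_Suc)
  ultimately show ?thesis
    unfolding polylog_defect_def[abs_def] using DERIV_diff[OF DERIV_const]
    by (fastforce simp: Suc T_def)
qed

lemma minus_ln_1_minus_tendsto_0: "((\<lambda>x::real. - ln (1 - x)) \<longlongrightarrow> 0) (at_right 0)"
  by real_asymp

text \<open>For \<open>j \<ge> 1\<close> the positive powers of \<open>ln (1 - x)\<close> kill all
  summands but \<open>i = 0\<close>, whose limit cancels the zeta value.\<close>

lemma polylog_defect_tendsto_0:
  assumes "r \<ge> 1"
  shows "(polylog_defect r j \<longlongrightarrow> 0) (at_right 0)"
proof (cases j)
  case 0
  have "((\<lambda>x::real. (- ln (1 - x)) ^ r / fact r) \<longlongrightarrow> 0 ^ r / fact r) (at_right 0)"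
    by (intro tendsto_intros minus_ln_1_minus_tendsto_0) auto
  then show ?thesis using assms by (simp add: polylog_defect_def[abs_def] 0 zero_power)
next
  case (Suc p)
  have "((\<lambda>x. \<Sum>i<r. (- ln (1 - x)) ^ i / fact i * polylog_ones (r + 1 - i) p (1 - x)) \<longlongrightarrow>
          (\<Sum>i<r. 0 ^ i / fact i * zeta_ones (r + 1 - i) p)) (at_right 0)"
    by (intro tendsto_intros minus_ln_1_minus_tendsto_0 polylog_ones_tendsto_zeta_ones) auto
  moreover have "(\<Sum>i<r. 0 ^ i / fact i * zeta_ones (r + 1 - i) p) = zeta_ones (r + 1) p"
    using assms by (subst sum.remove[of _ 0]) (auto simp: zero_power intro!: sum.neutral)
  ultimately show ?thesis
    unfolding polylog_defect_def[abs_def] using tendsto_diff[OF tendsto_const, of _ _ _ "zeta_ones (r + 1) p"]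
    by (fastforce simp: Suc)
qed

text \<open>Convergence of the defect to 0 alone cannot offset the unbounded powers of
  \<open>ln x\<close>. A rate is obtained from l'Hopital's rule: the defect is
  \<open>o(sqrt x)\<close>, while \<open>ln x ^ n * sqrt x\<close> tends to 0.\<close>

lemma ln_power_polylog_defect_tendsto_0:
  assumes "r \<ge> 1"
  shows "((\<lambda>x. ln x ^ n * polylog_defect r j x) \<longlongrightarrow> 0) (at_right 0)"
proof -
  have ev: "eventually (\<lambda>x::real. 0 < x \<and> x < 1) (at_right 0)"
    by (auto simp: eventually_at_right[of 0 1] intro: exI[of _ 1])
  \<comment> \<open>The square root absorbs the logarithmic singularity of the derivative of the defect.\<close>
  have lim: "((\<lambda>x. polylog_defect r j x / sqrt x) \<longlongrightarrow> 0) (at_right 0)"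
  proof (rule lhopital_right_0)
    show "(sqrt \<longlongrightarrow> 0) (at_right 0)" by real_asymp
    show "((\<lambda>x. (- ln (1 - x)) ^ (r - 1) / fact (r - 1) / (1 - x) * ((- ln x) ^ j / fact j) /
            (inverse (sqrt x) / 2)) \<longlongrightarrow> 0) (at_right 0)"
    proof -
      have 1: "((\<lambda>x::real. (- ln (1 - x)) ^ (r - 1) / fact (r - 1) / (1 - x)) \<longlongrightarrow>
              0 ^ (r - 1) / fact (r - 1) / (1 - 0)) (at_right 0)"
        by (intro tendsto_intros minus_ln_1_minus_tendsto_0) auto
      have 2: "((\<lambda>x::real. (- ln x) ^ j / fact j / (inverse (sqrt x) / 2)) \<longlongrightarrow> 0) (at_right 0)"
        by real_asymp
      show ?thesis using tendsto_mult[OF 1 2] by (simp add: mult_ac)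
    qed
  qed (use ev polylog_defect_tendsto_0[OF assms] polylog_defect_has_derivative[OF assms] in
        \<open>auto elim!: eventually_mono intro: DERIV_real_sqrt\<close>)
  have "((\<lambda>x. (ln x ^ n * sqrt x) * (polylog_defect r j x / sqrt x)) \<longlongrightarrow> 0 * 0) (at_right 0)"
    by (rule tendsto_mult[OF _ lim]) real_asymp
  moreover have "eventually (\<lambda>x. (ln x ^ n * sqrt x) * (polylog_defect r j x / sqrt x) =
      ln x ^ n * polylog_defect r j x) (at_right 0)"
    using ev by (rule eventually_mono) auto
  ultimately show ?thesis
    using Lim_transform_eventually by fastforce
qed

section \<open>Induction on the leading index\<close>

text \<open>This is the binomial expansion of \<open>(- t + t) ^ Suc n / fact (Suc n)\<close>. The
  exponent is a successor because the zeroth power would give 1.\<close>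

lemma sum_divided_powers_minus:
  fixes t :: real
  shows "(\<Sum>j\<le>Suc n. t ^ (Suc n - j) / fact (Suc n - j) * ((- t) ^ j / fact j)) = 0"
proof -
  have "(\<Sum>j\<le>Suc n. t ^ (Suc n - j) / fact (Suc n - j) * ((- t) ^ j / fact j))
      = (- t + t) ^ Suc n / fact (Suc n)"
    unfolding binomial_ring sum_divide_distrib
    by (intro sum.cong) (auto simp: binomial_fact mult_ac simp del: fact_Suc)
  then show ?thesis by simp
qed

lemma polylog_ones_eq_sum_defects:
  assumes "0 < x" "x < 1"
  shows "polylog_ones (Suc K) q x =
    (\<Sum>j\<le>K. ln x ^ (K - j) / fact (K - j) * polylog_defect (Suc q) j x)"
  using assms
proof (induction K arbitrary: x)
  case (0 x)
  then show ?case using polylog_ones_1[of x q] by (simp add: polylog_defect_def)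
next
  case (Suc K x)
  define R where "R = (\<lambda>x. \<Sum>j\<le>Suc K. ln x ^ (Suc K - j) / fact (Suc K - j) * polylog_defect (Suc q) j x)"
  define f where "f = (\<lambda>x. polylog_ones (Suc (Suc K)) q x - R x)"
  have deriv: "(f has_real_derivative 0) (at y)" if y: "0 < y" "y < 1" for y
  proof -
    define b where "b = (- ln (1 - y)) ^ q / fact q / (1 - y)"
    \<comment> \<open>By the product rule, \<open>U j\<close> differentiates the power of
      \<open>ln\<close>, which is constant for \<open>j = Suc K\<close>, and \<open>b * W j\<close>
      differentiates the defect. The \<open>U j\<close> reassemble the induction hypothesis divided
      by \<open>y\<close>; the \<open>W j\<close> cancel.\<close>
    define U where "U = (\<lambda>j. if j \<le> K then ln y ^ (K - j) / fact (K - j) * polylog_defect (Suc q) j y / y else 0)"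
    define W where "W = (\<lambda>j. ln y ^ (Suc K - j) / fact (Suc K - j) * ((- ln y) ^ j / fact j))"
    have D: "(polylog_defect (Suc q) j has_real_derivative b * ((- ln y) ^ j / fact j)) (at y)" for j
      using polylog_defect_has_derivative[of "Suc q" y j] y by (simp add: b_def)
    have "((\<lambda>x. ln x ^ (Suc K - j) / fact (Suc K - j) * polylog_defect (Suc q) j x)
            has_real_derivative U j + b * W j) (at y)" if "j \<le> Suc K" for j
    proof (cases "j \<le> K")
      case True
      have "((\<lambda>x. ln x ^ (Suc K - j) / fact (Suc K - j)) has_real_derivative
              ln y ^ (K - j) / fact (K - j) * (1 / y)) (at y)"
        using has_derivative_divided_power[OF DERIV_ln_divide[OF y(1)], of "K - j"] True
        by (simp add: Suc_diff_le)
      from DERIV_mult[OF this D] show ?thesis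
        by (rule DERIV_cong) (use True in \<open>simp add: U_def W_def mult_ac\<close>)
    next
      case False
      then have "j = Suc K" using that by simp
      with D[of j] show ?thesis by (simp add: U_def W_def)
    qed
    then have "(R has_real_derivative (\<Sum>j\<le>Suc K. U j + b * W j)) (at y)"
      unfolding R_def by (intro DERIV_sum) auto
    also have "(\<Sum>j\<le>Suc K. U j + b * W j) = (\<Sum>j\<le>Suc K. U j) + b * (\<Sum>j\<le>Suc K. W j)"
      by (simp add: sum.distrib sum_distrib_left distrib_left)
    also have "(\<Sum>j\<le>Suc K. W j) = 0"
      unfolding W_def by (rule sum_divided_powers_minus)
    also have "(\<Sum>j\<le>Suc K. U j) = polylog_ones (Suc K) q y / y"
      using Suc.IH[OF y] by (simp add: U_def sum_divide_distrib)
    finally have "(R has_real_derivative polylog_ones (Suc K) q y / y) (at y)" by simp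
    moreover have "(polylog_ones (Suc (Suc K)) q has_real_derivative polylog_ones (Suc K) q y / y) (at y)"
      using y by (intro polylog_ones_has_derivative) auto
    ultimately show ?thesis unfolding f_def using DERIV_diff by fastforce
  qed
  have "(R \<longlongrightarrow> (\<Sum>j\<le>Suc K. 0 / fact (Suc K - j))) (at_right 0)"
    unfolding R_def times_divide_eq_left
    by (intro tendsto_sum tendsto_divide ln_power_polylog_defect_tendsto_0) auto
  then have "(f \<longlongrightarrow> 0 - 0) (at_right 0)"
    unfolding f_def by (intro tendsto_diff polylog_ones_tendsto_0) auto
  \<comment> \<open>\<open>f\<close> is known to be constant only on the open interval, so its value
    is read off from the limit at 0 from the right.\<close>
  moreover have "eventually (\<lambda>y. f y = f x) (at_right 0)"
  proof (rule eventually_at_rightI[of 0 1])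
    fix y :: real assume "y \<in> {0<..<1}"
    then show "f y = f x"
      using Suc.prems deriv by (intro DERIV_isconst3[of 0 1]) auto
  qed auto
  then have "(f \<longlongrightarrow> f x) (at_right 0)" by (rule tendsto_eventually)
  ultimately have "f x = 0" using tendsto_unique[of "at_right (0::real)"] by fastforce
  then show ?case by (simp add: f_def R_def)
qed

theorem theorem2p1:
  fixes k r :: nat and x :: real
  assumes "k \<ge> 1" and "r \<ge> 1" and "0 < x" and "x < 1"
  shows "multi_polylog (k # replicate (r - 1) 1) x =
    (\<Sum>j = 1..k - 1. ln x ^ (k - 1 - j) / fact (k - 1 - j) *
       (multi_zeta ((r + 1) # replicate (j - 1) 1) -
        (\<Sum>i = 0..r - 1. (- 1) ^ i / fact i * ln (1 - x) ^ i *
           multi_polylog ((r + 1 - i) # replicate (j - 1) 1) (1 - x)))) +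
    (- 1) ^ r * (ln x ^ (k - 1) * ln (1 - x) ^ r) / (fact (k - 1) * fact r)"
proof -
  obtain K q where Kq: "k = Suc K" "r = Suc q"
    using assms by (metis Suc_le_D One_nat_def)
  define e where "e = (\<lambda>j. ln x ^ (K - j) / fact (K - j))"
  have defect: "polylog_defect r j x = multi_zeta ((r + 1) # replicate (j - 1) 1) -
        (\<Sum>i = 0..r - 1. (- 1) ^ i / fact i * ln (1 - x) ^ i *
           multi_polylog ((r + 1 - i) # replicate (j - 1) 1) (1 - x))" if "j \<ge> 1" for j
  proof -
    have "(\<Sum>i = 0..r - 1. (- 1) ^ i / fact i * ln (1 - x) ^ i *
           multi_polylog ((r + 1 - i) # replicate (j - 1) 1) (1 - x))
        = (\<Sum>i<r. (- ln (1 - x)) ^ i / fact i * polylog_ones (r + 1 - i) (j - 1) (1 - x))"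
    proof (rule sum.cong)
      fix i assume "i \<in> {..<r}"
      then show "(- 1) ^ i / fact i * ln (1 - x) ^ i *
           multi_polylog ((r + 1 - i) # replicate (j - 1) 1) (1 - x)
         = (- ln (1 - x)) ^ i / fact i * polylog_ones (r + 1 - i) (j - 1) (1 - x)"
        using assms by (subst multi_polylog_ones) (auto simp: power_minus[of "ln (1 - x)"])
    qed (use Kq in auto)
    then show ?thesis
      unfolding polylog_defect_def using that assms by (subst multi_zeta_ones) auto
  qed
  have "multi_polylog (k # replicate (r - 1) 1) x = polylog_ones (Suc K) q x"
    using assms Kq by (subst multi_polylog_ones) auto
  also have "\<dots> = (\<Sum>j\<le>K. e j * polylog_defect r j x)"
    using polylog_ones_eq_sum_defects[OF assms(3,4)] by (simp add: e_def Kq)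
  \<comment> \<open>The index \<open>j = 0\<close> carries no zeta value; it yields the separate
    last term of the formula.\<close>
  also have "\<dots> = (\<Sum>j = 1..K. e j * polylog_defect r j x) + e 0 * polylog_defect r 0 x"
    by (simp add: atMost_atLeast0 sum.atLeast_Suc_atMost)
  also have "e 0 * polylog_defect r 0 x =
      (- 1) ^ r * (ln x ^ K * ln (1 - x) ^ r) / (fact K * fact r)"
    by (simp add: e_def polylog_defect_def power_minus[of "ln (1 - x)"])
  finally show ?thesis by (simp add: Kq(1) e_def defect)
qed

end
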